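(* Let $G_0$ be the graph with vertices $w_1,\dots,w_7$ and edges $w_1w_2,\,w_1w_5,\,w_2w_5,\,w_2w_3,\,w_3w_4,\,w_4w_5,\,w_3w_6,\,w_4w_7$, and let $G_2$ be the graph with vertices $u_1,\dots,u_8$ and edges $u_1u_2,\,u_1u_3,\,u_2u_3,\,u_2u_4,\,u_3u_5,\,u_4u_5,\,u_4u_6,\,u_5u_7,\,u_6u_7,\,u_6u_8,\,u_7u_8$. Let $G_3$ be the graph obtained from the disjoint union of $G_0$ and $G_2$ by identifying the vertex $w_6$ of $G_0$ with the vertex $u_1$ of $G_2$. Then $G_3$ is subcubic and outerplanar, and has no $(1,2^4)$-packing edge-coloring.
   Context: A graph is subcubic if its maximum degree is at most $3$. The distance between two distinct edges of a graph $G$ is their distance in the line graph of $G$, so edges sharing an endpoint are at distance $1$. For a non-decreasing sequence $S=(s_1,\dots,s_k)$ of positive integers, an $S$-packing edge-coloring ($S$-coloring) of $G$ is a partition of $E(G)$ into (possibly empty) classes $E_1,\dots,E_k$ such that for each $i$ any two distinct edges in $E_i$ are at distance at least $s_i+1$. Exponents denote repetition: $(1,2^4)=(1,2,2,2,2)$. *)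

theory Defs
  imports "HOL-Analysis.Analysis" "HOL-Library.Extended_Nat"
begin

record 'a graph =
  verts :: "'a set"
  edges :: "'a set set"

definition simple_graph :: "'a graph \<Rightarrow> bool" where
  "simple_graph G \<longleftrightarrow> finite (verts G) \<and> (\<forall>e\<in>edges G. e \<subseteq> verts G \<and> card e = 2)"

definition degree :: "'a graph \<Rightarrow> 'a \<Rightarrow> nat" where
  "degree G v = card {e \<in> edges G. v \<in> e}"

text \<open>The inserted \<open>0\<close> only matters for the graph without vertices.\<close>
definition max_degree :: "'a graph \<Rightarrow> nat" where
  "max_degree G = Max (insert 0 (degree G ` verts G))"

definition subcubic :: "'a graph \<Rightarrow> bool" where
  "subcubic G \<longleftrightarrow> max_degree G \<le> 3"

definition is_walk :: "'a graph \<Rightarrow> 'a \<Rightarrow> 'a list \<Rightarrow> 'a \<Rightarrow> bool" where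
  "is_walk G u p v \<longleftrightarrow> p \<noteq> [] \<and> hd p = u \<and> last p = v \<and> set p \<subseteq> verts G \<and>
     successively (\<lambda>x y. {x, y} \<in> edges G) p"

text \<open>A walk is the list of its vertices, so its length is one less than the length of the
  list. The infimum over the empty set is \<open>\<infinity>\<close>, the distance between different components.\<close>
definition graph_dist :: "'a graph \<Rightarrow> 'a \<Rightarrow> 'a \<Rightarrow> enat" where
  "graph_dist G u v = (INF p \<in> {p. is_walk G u p v}. enat (length p - 1))"

definition line_graph :: "'a graph \<Rightarrow> 'a set graph" where
  "line_graph G = \<lparr>verts = edges G,
     edges = {{e, f} | e f. e \<in> edges G \<and> f \<in> edges G \<and> e \<noteq> f \<and> e \<inter> f \<noteq> {}}\<rparr>"

text \<open>\<open>S\<close> is meant to be a non-decreasing list of positive numbers; the list and the classes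
  \<open>C\<close> are indexed from \<open>0\<close>.\<close>
definition packing_edge_coloring :: "nat list \<Rightarrow> 'a graph \<Rightarrow> (nat \<Rightarrow> 'a set set) \<Rightarrow> bool" where
  "packing_edge_coloring S G C \<longleftrightarrow>
     (\<Union>i<length S. C i) = edges G \<and>
     disjoint_family_on C {..<length S} \<and>
     (\<forall>i<length S. \<forall>e\<in>C i. \<forall>f\<in>C i. e \<noteq> f \<longrightarrow>
        graph_dist (line_graph G) e f \<ge> enat (S ! i + 1))"

text \<open>\<open>pos\<close> places the vertices and \<open>\<gamma>\<close> draws each edge as a Jordan arc.\<close>
definition plane_drawing ::
    "'a graph \<Rightarrow> ('a \<Rightarrow> real^2) \<Rightarrow> ('a set \<Rightarrow> real \<Rightarrow> real^2) \<Rightarrow> bool" where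
  "plane_drawing G pos \<gamma> \<longleftrightarrow>
     inj_on pos (verts G) \<and>
     (\<forall>e\<in>edges G. arc (\<gamma> e) \<and> {pathstart (\<gamma> e), pathfinish (\<gamma> e)} = pos ` e \<and>
        path_image (\<gamma> e) \<inter> pos ` verts G = pos ` e) \<and>
     (\<forall>e\<in>edges G. \<forall>f\<in>edges G. e \<noteq> f \<longrightarrow>
        path_image (\<gamma> e) \<inter> path_image (\<gamma> f) = pos ` (e \<inter> f))"

definition drawing_image ::
    "'a graph \<Rightarrow> ('a \<Rightarrow> real^2) \<Rightarrow> ('a set \<Rightarrow> real \<Rightarrow> real^2) \<Rightarrow> (real^2) set" where
  "drawing_image G pos \<gamma> = pos ` verts G \<union> (\<Union>e\<in>edges G. path_image (\<gamma> e))"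

text \<open>The drawing of a finite graph is compact, so its complement has exactly one unbounded
  component, the outer face, and this component is \<^const>\<open>outside\<close> of the drawing.\<close>
definition outerplanar :: "'a graph \<Rightarrow> bool" where
  "outerplanar G \<longleftrightarrow> (\<exists>pos \<gamma>. plane_drawing G pos \<gamma> \<and>
     pos ` verts G \<subseteq> frontier (outside (drawing_image G pos \<gamma>)))"

definition disjoint_union :: "'a graph \<Rightarrow> 'b graph \<Rightarrow> ('a + 'b) graph" where
  "disjoint_union G H = \<lparr>verts = verts G <+> verts H,
     edges = (image Inl) ` edges G \<union> (image Inr) ` edges H\<rparr>"

text \<open>The merged vertex is called \<open>x\<close>. The result is a simple graph if \<open>x\<close> and \<open>y\<close> are not
  adjacent; edges to a common neighbour are merged.\<close>
definition identify :: "'a \<Rightarrow> 'a \<Rightarrow> 'a graph \<Rightarrow> 'a graph" where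
  "identify x y G = (let q = (\<lambda>z. if z = y then x else z) in
     \<lparr>verts = q ` verts G, edges = (image q) ` edges G\<rparr>)"

text \<open>The vertex \<open>w\<^sub>i\<close> of \<open>G\<^sub>0\<close> and the vertex \<open>u\<^sub>i\<close> of \<open>G\<^sub>2\<close> are both represented by the number \<open>i\<close>;
  in \<open>G\<^sub>3\<close> they become \<open>Inl i\<close> and \<open>Inr i\<close>.\<close>
definition G0 :: "nat graph" where
  "G0 = \<lparr>verts = {1..7},
     edges = {{1,2}, {1,5}, {2,5}, {2,3}, {3,4}, {4,5}, {3,6}, {4,7}}\<rparr>"

definition G2 :: "nat graph" where
  "G2 = \<lparr>verts = {1..8},
     edges = {{1,2}, {1,3}, {2,3}, {2,4}, {3,5}, {4,5}, {4,6}, {5,7}, {6,7}, {6,8}, {7,8}}\<rparr>"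

definition G3 :: "(nat + nat) graph" where
  "G3 = identify (Inl 6) (Inr 1) (disjoint_union G0 G2)"

lemma simple_graph_G3: "simple_graph G3"
  by (simp add: simple_graph_def G3_def identify_def disjoint_union_def G0_def G2_def Let_def
      card_2_iff' image_iff Plus_def)

end

(* Outerplanarity: placing the vertices on a parabola in a suitable cyclic order turns the edges
   into noncrossing chords, and every vertex can be reached from the outside of the parabola.

   Non-colorability: five edges at pairwise distance at most 2 need five different classes unless
   one of them lies in the class of exponent 1, so this class is a matching meeting every such set
   of five edges. Inside G0 this excludes the edge w3w6 from the matching; inside G2 together with
   w3w6 it forces w3w6 to belong to the matching. *)
theory Submission
  imports Defs
begin

section \<open>Chords of the parabola y = x^2\<close>

definition parabola_point :: "real \<Rightarrow> real^2" where
  "parabola_point x = vector [x, x^2]"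

lemma parabola_point_nth [simp]:
  "parabola_point x $ 1 = x" "parabola_point x $ 2 = x^2"
  by (simp_all add: parabola_point_def)

lemma parabola_point_eq_iff [simp]: "parabola_point x = parabola_point y \<longleftrightarrow> x = y"
  by (metis parabola_point_nth(1))

lemma vec2_eq_iff: "z = w \<longleftrightarrow> z $ 1 = w $ 1 \<and> z $ 2 = w $ 2" for z w :: "real^2"
  by (simp add: vec_eq_iff forall_2)

text \<open>The line through the points at abscissas \<open>a\<close> and \<open>b\<close> has slope
  \<open>a + b\<close> and intercept \<open>- a * b\<close>, so membership in a chord becomes linear
  in the coordinates of \<open>z\<close>.\<close>

lemma parabola_chord:
  assumes "a < b"
  shows "z \<in> closed_segment (parabola_point a) (parabola_point b) \<longleftrightarrow>
    a \<le> z $ 1 \<and> z $ 1 \<le> b \<and> z $ 2 = (a + b) * z $ 1 - a * b"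
proof
  assume "z \<in> closed_segment (parabola_point a) (parabola_point b)"
  then obtain u where u: "0 \<le> u" "u \<le> 1"
    "z = (1 - u) *\<^sub>R parabola_point a + u *\<^sub>R parabola_point b"
    by (auto simp: closed_segment_def)
  have z: "z $ 1 = a + u * (b - a)" "z $ 2 = (1 - u) * a^2 + u * b^2"
    by (simp_all add: u(3) algebra_simps)
  have "0 \<le> u * (b - a)" "u * (b - a) \<le> 1 * (b - a)"
    using u assms by (auto intro: mult_right_mono)
  then show "a \<le> z $ 1 \<and> z $ 1 \<le> b \<and> z $ 2 = (a + b) * z $ 1 - a * b"
    by (simp add: z algebra_simps power2_eq_square)
next
  assume z: "a \<le> z $ 1 \<and> z $ 1 \<le> b \<and> z $ 2 = (a + b) * z $ 1 - a * b"
  define u where "u = (z $ 1 - a) / (b - a)"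
  have u: "0 \<le> u" "u \<le> 1" "z $ 1 = a + u * (b - a)"
    using z assms by (auto simp: u_def)
  have "z = (1 - u) *\<^sub>R parabola_point a + u *\<^sub>R parabola_point b"
    using z by (simp add: vec2_eq_iff u(3) algebra_simps power2_eq_square)
  then show "z \<in> closed_segment (parabola_point a) (parabola_point b)"
    using u by (auto simp: closed_segment_def)
qed

text \<open>A line meets the parabola at most twice; hence no edge drawn as a chord passes through a
  third vertex.\<close>

lemma parabola_point_in_chord:
  assumes "a < b" "parabola_point x \<in> closed_segment (parabola_point a) (parabola_point b)"
  shows "x = a \<or> x = b"
proof -
  have "(x - a) * (x - b) = 0"
    using assms by (simp add: parabola_chord algebra_simps power2_eq_square)
  then show ?thesis by simp
qed

text \<open>At abscissa t the first chord lies \<open>(t - a) * (b - t)\<close> above the parabola.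
  If \<open>c < b\<close>, the second interval is nested in the first, and heights are compared;
  otherwise the intervals can only touch at \<open>b = c\<close>.\<close>

lemma parabola_chords_disjoint:
  assumes "a < b" "c < d" "a \<le> c" "c < b \<Longrightarrow> d \<le> b" "(a, b) \<noteq> (c, d)"
    and za: "z \<in> closed_segment (parabola_point a) (parabola_point b)"
    and zc: "z \<in> closed_segment (parabola_point c) (parabola_point d)"
  shows "\<exists>x \<in> {a, b} \<inter> {c, d}. z = parabola_point x"
proof -
  define t where "t = z $ 1"
  have t: "a \<le> t" "t \<le> b" "c \<le> t" "t \<le> d"
    and z2: "z $ 2 = (a + b) * t - a * b" "z $ 2 = (c + d) * t - c * d"
    using za zc assms(1,2) by (auto simp: parabola_chord t_def)
  have "t \<in> {a, b} \<inter> {c, d}"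
  proof (cases "c < b")
    case True
    then have db: "d \<le> b" using assms by simp
    have eq: "(t - a) * (b - t) = (t - c) * (d - t)"
      using z2 by (simp add: algebra_simps)
    \<comment> \<open>The outer height exceeds the inner one by two nonnegative terms. Equal heights
      make both vanish, which puts \<open>t\<close> at a shared endpoint because the chords
      differ.\<close>
    have "(t - a) * (b - t) = (c - a) * (b - t) + (t - c) * (b - d) + (t - c) * (d - t)"
      by (simp add: algebra_simps)
    moreover have "(c - a) * (b - t) \<ge> 0" "(t - c) * (b - d) \<ge> 0"
      using t db assms by auto
    ultimately have "(c - a) * (b - t) = 0" "(t - c) * (b - d) = 0"
      using eq by linarith+
    then show ?thesis using assms t db by auto
  next
    case False
    then show ?thesis using t by auto
  qed
  moreover have "z = parabola_point t"
  proof -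
    have "(t - a) * (t - b) = 0" using calculation by auto
    then have "z $ 2 = t^2" using z2(1) by (simp add: algebra_simps power2_eq_square)
    then show ?thesis by (simp add: vec2_eq_iff t_def)
  qed
  ultimately show ?thesis by blast
qed

section \<open>The region above the parabola and drawings inside it\<close>

definition parabola_epigraph :: "(real^2) set" where
  "parabola_epigraph = {z. (z $ 1)^2 \<le> z $ 2}"

lemma parabola_point_in_epigraph [simp]: "parabola_point x \<in> parabola_epigraph"
  by (simp add: parabola_epigraph_def)

lemma convex_parabola_epigraph: "convex parabola_epigraph"
  unfolding parabola_epigraph_def
proof (rule convexI)
  fix x y :: "real^2" and u v :: real
  assume *: "x \<in> {z. (z $ 1)^2 \<le> z $ 2}" "y \<in> {z. (z $ 1)^2 \<le> z $ 2}" "0 \<le> u" "0 \<le> v" "u + v = 1"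
  have "(u * x $ 1 + v * y $ 1)^2 \<le> u * (x $ 1)^2 + v * (y $ 1)^2"
  proof -
    have v: "v = 1 - u" using * by simp
    have "u * (x $ 1)^2 + v * (y $ 1)^2 - (u * x $ 1 + v * y $ 1)^2 = u * v * (x $ 1 - y $ 1)^2"
      unfolding v by (simp add: algebra_simps power2_eq_square)
    moreover have "u * v * (x $ 1 - y $ 1)^2 \<ge> 0" using * by simp
    ultimately show ?thesis by linarith
  qed
  also have "\<dots> \<le> u * x $ 2 + v * y $ 2"
    using * by (intro add_mono mult_left_mono) auto
  finally show "u *\<^sub>R x + v *\<^sub>R y \<in> {z. (z $ 1)^2 \<le> z $ 2}" by simp
qed

text \<open>The outside of a convex set is its whole complement, and the points straight below
  \<open>parabola_point x\<close> lie there and converge to it.\<close>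

lemma parabola_point_in_closure_outside:
  "parabola_point x \<in> closure (outside parabola_epigraph)"
proof -
  let ?y = "\<lambda>n::nat. parabola_point x - inverse (real (Suc n)) *\<^sub>R axis 2 1"
  have "?y n \<in> outside parabola_epigraph" for n
    using outside_convex[OF convex_parabola_epigraph]
    by (simp add: parabola_epigraph_def axis_def)
  moreover have "?y \<longlonglongrightarrow> parabola_point x - 0 *\<^sub>R axis 2 1"
    by (intro tendsto_intros LIMSEQ_inverse_real_of_nat)
  ultimately show ?thesis
    unfolding closure_sequential by (intro exI[of _ ?y]) auto
qed

text \<open>Vertices go on the parabola at abscissa \<open>num\<close>, edges become chords. By
  \<open>noncrossing\<close>, the intervals spanned by two edges are nested or share at most an
  endpoint, so the chords meet only in common vertices.\<close>

lemma outerplanar_if_noncrossing: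
  fixes num :: "'a \<Rightarrow> real"
  assumes simple: "simple_graph G" and inj: "inj_on num (verts G)"
    and noncrossing: "\<And>e f. e \<in> edges G \<Longrightarrow> f \<in> edges G \<Longrightarrow>
      Min (num ` e) < Min (num ` f) \<Longrightarrow> Min (num ` f) < Max (num ` e) \<Longrightarrow>
      Max (num ` f) \<le> Max (num ` e)"
  shows "outerplanar G"
proof -
  define pos where "pos = parabola_point \<circ> num"
  define lo where "lo = (\<lambda>e. Min (num ` e))"
  define hi where "hi = (\<lambda>e. Max (num ` e))"
  define \<gamma> where "\<gamma> = (\<lambda>e. linepath (parabola_point (lo e)) (parabola_point (hi e)))"
  have edge: "e \<subseteq> verts G" "lo e < hi e" "num ` e = {lo e, hi e}" if e: "e \<in> edges G" for e
  proof -
    have e2: "e \<subseteq> verts G" "card e = 2" using simple e by (auto simp: simple_graph_def)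
    then obtain u v where uv: "e = {u, v}" "u \<noteq> v" by (auto simp: card_2_iff)
    have "num u \<noteq> num v" using inj uv e2 by (auto simp: inj_on_def)
    then show "e \<subseteq> verts G" "lo e < hi e" "num ` e = {lo e, hi e}"
      using e2 by (auto simp: lo_def hi_def uv min_def max_def)
  qed
  have pos_image: "pos ` e = {parabola_point (lo e), parabola_point (hi e)}" if "e \<in> edges G" for e
    unfolding pos_def image_comp[symmetric] edge(3)[OF that] by simp
  have \<gamma>_image: "path_image (\<gamma> e) = closed_segment (parabola_point (lo e)) (parabola_point (hi e))" for e
    by (simp add: \<gamma>_def)
  have inj_pos: "inj_on pos (verts G)"
    using inj by (auto simp: pos_def inj_on_def)
  \<comment> \<open>Of two edges, \<open>e\<close> is the one whose interval starts first, or the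
    longer one if both start together; the other order follows by symmetry.\<close>
  have meet: "path_image (\<gamma> e) \<inter> path_image (\<gamma> f) \<subseteq> pos ` (e \<inter> f)"
    if e: "e \<in> edges G" and f: "f \<in> edges G" and ne: "e \<noteq> f" and le: "lo e \<le> lo f" 
      and tie: "lo e = lo f \<Longrightarrow> hi f \<le> hi e" for e f
  proof
    fix z assume z: "z \<in> path_image (\<gamma> e) \<inter> path_image (\<gamma> f)"
    have "num ` e \<noteq> num ` f"
      using ne inj edge(1)[OF e] edge(1)[OF f] by (simp add: inj_on_image_eq_iff)
    then have "(lo e, hi e) \<noteq> (lo f, hi f)" using edge(3)[OF e] edge(3)[OF f] by auto
    moreover have "hi f \<le> hi e" if "lo f < hi e"
      using noncrossing[OF e f] le tie that unfolding lo_def hi_def by fastforce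
    ultimately obtain x where x: "x \<in> {lo e, hi e} \<inter> {lo f, hi f}" "z = parabola_point x"
      using parabola_chords_disjoint[of "lo e" "hi e" "lo f" "hi f" z] z le edge(2)[OF e] edge(2)[OF f]
      by (auto simp: \<gamma>_image)
    then have "x \<in> num ` e \<inter> num ` f" using edge(3)[OF e] edge(3)[OF f] by simp
    also have "\<dots> = num ` (e \<inter> f)"
      using inj edge(1)[OF e] edge(1)[OF f] by (simp add: inj_on_image_Int)
    finally show "z \<in> pos ` (e \<inter> f)" using x by (auto simp: pos_def)
  qed
  have drawing: "plane_drawing G pos \<gamma>"
    unfolding plane_drawing_def
  proof (intro conjI ballI impI)
    fix e assume e: "e \<in> edges G"
    show "arc (\<gamma> e)" using edge(2)[OF e] by (simp add: \<gamma>_def arc_linepath)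
    show "{pathstart (\<gamma> e), pathfinish (\<gamma> e)} = pos ` e"
      using pos_image[OF e] by (simp add: \<gamma>_def)
    show "path_image (\<gamma> e) \<inter> pos ` verts G = pos ` e"
    proof
      show "path_image (\<gamma> e) \<inter> pos ` verts G \<subseteq> pos ` e"
        unfolding \<gamma>_image pos_image[OF e]
        by (auto simp: pos_def dest!: parabola_point_in_chord[OF edge(2)[OF e]])
      have "pos ` e \<subseteq> pos ` verts G" by (rule image_mono[OF edge(1)[OF e]])
      then show "pos ` e \<subseteq> path_image (\<gamma> e) \<inter> pos ` verts G"
        unfolding \<gamma>_image pos_image[OF e] by auto
    qed
  next
    fix e f assume e: "e \<in> edges G" and f: "f \<in> edges G" and ne: "e \<noteq> f"
    have "path_image (\<gamma> e) \<inter> path_image (\<gamma> f) \<subseteq> pos ` (e \<inter> f)"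
    proof (cases "lo e < lo f \<or> lo e = lo f \<and> hi f \<le> hi e")
      case True
      then show ?thesis using meet[OF e f ne] by auto
    next
      case False
      then show ?thesis using meet[OF f e] ne by (auto simp: Int_commute)
    qed
    moreover have "pos ` e \<subseteq> path_image (\<gamma> e)" "pos ` f \<subseteq> path_image (\<gamma> f)"
      unfolding \<gamma>_image pos_image[OF e] pos_image[OF f] by simp_all
    ultimately show "path_image (\<gamma> e) \<inter> path_image (\<gamma> f) = pos ` (e \<inter> f)" by blast
  qed (rule inj_pos)
  let ?D = "drawing_image G pos \<gamma>"
  \<comment> \<open>Since \<open>outside\<close> is antitone, everything below the parabola is
    outside the drawing. The vertices are limits of such points, but belong to the drawing
    themselves.\<close>
  have "?D \<subseteq> parabola_epigraph"
    unfolding drawing_image_def \<gamma>_image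
    by (intro Un_least UN_least closed_segment_subset convex_parabola_epigraph)
      (auto simp: pos_def)
  then have "closure (outside parabola_epigraph) \<subseteq> closure (outside ?D)"
    by (intro closure_mono outside_mono)
  then have "pos ` verts G \<subseteq> closure (outside ?D)"
    using parabola_point_in_closure_outside by (auto simp: pos_def)
  moreover have "pos ` verts G \<inter> interior (outside ?D) = {}"
    using outside_no_overlap[of ?D] interior_subset[of "outside ?D"]
    unfolding drawing_image_def by blast
  ultimately have "pos ` verts G \<subseteq> frontier (outside ?D)"
    by (auto simp: frontier_def)
  then show ?thesis using drawing by (auto simp: outerplanar_def)
qed

section \<open>Short distances in the line graph\<close>

lemma line_graph_dist_le_1:
  assumes "e \<in> edges G" "f \<in> edges G" "e \<noteq> f" "e \<inter> f \<noteq> {}"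
  shows "graph_dist (line_graph G) e f \<le> 1"
proof -
  have "is_walk (line_graph G) e [e, f] f"
    using assms by (auto simp: is_walk_def line_graph_def)
  then show ?thesis
    unfolding graph_dist_def by (intro INF_lower2[of "[e, f]"]) (auto simp: one_enat_def)
qed

lemma line_graph_dist_le_2:
  assumes "e \<in> edges G" "f \<in> edges G" "e \<noteq> f" "g \<in> edges G" "e \<inter> g \<noteq> {}" "g \<inter> f \<noteq> {}"
  shows "graph_dist (line_graph G) e f \<le> 2"
proof (cases "g = e \<or> g = f")
  \<comment> \<open>Here \<open>e\<close> and \<open>f\<close> share an endpoint, and
    \<open>[e, g, f]\<close> is not a walk because the line graph has no loops.\<close>
  case True
  then have "graph_dist (line_graph G) e f \<le> 1"
    using assms by (intro line_graph_dist_le_1) auto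
  also have "(1::enat) \<le> 2" by simp
  finally show ?thesis .
next
  case False
  then have "is_walk (line_graph G) e [e, g, f] f"
    using assms by (auto simp: is_walk_def line_graph_def)
  then show ?thesis
    unfolding graph_dist_def by (intro INF_lower2[of "[e, g, f]"]) (auto simp: numeral_eq_enat)
qed

section \<open>The class of exponent 1 in a coloring\<close>

context
  fixes G :: "'a graph" and C
  assumes coloring: "packing_edge_coloring [1, 2, 2, 2, 2] G C"
begin

lemma first_class_matching:
  assumes "e \<in> C 0" "f \<in> C 0" "e \<noteq> f"
  shows "e \<inter> f = {}"
proof (rule ccontr)
  assume "e \<inter> f \<noteq> {}"
  moreover have "e \<in> edges G" "f \<in> edges G"
    using assms coloring by (auto simp: packing_edge_coloring_def)
  ultimately have "graph_dist (line_graph G) e f \<le> 1"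
    using assms by (intro line_graph_dist_le_1) auto
  moreover have "graph_dist (line_graph G) e f \<ge> enat ([1, 2, 2, 2, 2] ! 0 + 1)"
    using assms coloring unfolding packing_edge_coloring_def by (auto simp del: nth_Cons_0)
  ultimately have "enat 2 \<le> enat 1"
    by (auto simp: one_enat_def numeral_2_eq_2 dest: order_trans)
  then show False by simp
qed

text \<open>Pigeonhole: if \<open>K\<close> avoided \<open>C 0\<close>, two of its five edges would
  share one of the four classes of exponent 2 and be at distance at least 3, whereas
  \<open>close\<close> gives at most 2.\<close>

lemma close_edges_meet_first_class:
  assumes sub: "K \<subseteq> edges G" and card: "card K = 5"
    and close: "\<forall>e\<in>K. \<forall>f\<in>K. \<exists>g\<in>edges G. e \<inter> g \<noteq> {} \<and> g \<inter> f \<noteq> {}"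
  shows "K \<inter> C 0 \<noteq> {}"
proof
  assume "K \<inter> C 0 = {}"
  moreover have "\<exists>i\<in>{1..4}. e \<in> C i" if "e \<in> K" "e \<notin> C 0" for e
  proof -
    have "(\<Union>i<length [1, 2, 2, 2, 2::nat]. C i) = edges G"
      using coloring[unfolded packing_edge_coloring_def] by (rule conjunct1)
    then obtain i where i: "i < length [1, 2, 2, 2, 2::nat]" "e \<in> C i"
      using \<open>e \<in> K\<close> sub by blast
    have "i \<noteq> 0" using i(2) that(2) by metis
    then show ?thesis using i by (intro bexI[of _ i]) auto
  qed
  ultimately have "\<forall>e\<in>K. \<exists>i\<in>{1..4}. e \<in> C i" by auto
  then obtain c where c: "\<And>e. e \<in> K \<Longrightarrow> c e \<in> {1..4::nat} \<and> e \<in> C (c e)" by metis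
  have "card (c ` K) \<le> card {1..4::nat}"
    using c by (intro card_mono) auto
  then have "card (c ` K) < card K" using card by simp
  then have "\<not> inj_on c K" by (rule pigeonhole)
  then obtain e f where ef: "e \<in> K" "f \<in> K" "e \<noteq> f" "c e = c f" by (auto simp: inj_on_def)
  define i where "i = c e"
  have i: "i \<in> {1..4}" "e \<in> C i" "f \<in> C i" using c[of e] c[of f] ef by (simp_all add: i_def)
  obtain g where g: "g \<in> edges G" "e \<inter> g \<noteq> {}" "g \<inter> f \<noteq> {}" using close ef by blast
  have "i < length [1, 2, 2, 2, 2::nat]" and entry: "[1, 2, 2, 2, 2] ! i + 1 = (3::nat)"
    using i(1) by (auto simp: numeral_eq_Suc atLeastAtMostSuc_conv)
  moreover have "\<forall>i<length [1, 2, 2, 2, 2::nat]. \<forall>e\<in>C i. \<forall>f\<in>C i. e \<noteq> f \<longrightarrow>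
      enat ([1, 2, 2, 2, 2] ! i + 1) \<le> graph_dist (line_graph G) e f"
    using coloring unfolding packing_edge_coloring_def by (elim conjE)
  ultimately have "enat ([1, 2, 2, 2, 2] ! i + 1) \<le> graph_dist (line_graph G) e f"
    using i(2,3) ef(3) by blast
  then have "enat 3 \<le> graph_dist (line_graph G) e f" unfolding entry .
  moreover have "graph_dist (line_graph G) e f \<le> enat 2"
    using line_graph_dist_le_2[OF _ _ ef(3) g] ef(1,2) sub by (auto simp: numeral_eq_enat)
  ultimately have "enat 3 \<le> enat 2" by (rule order_trans)
  then show False by simp
qed

end

section \<open>The graph \<open>G3\<close>, with \<open>Inl 6\<close> as the merged vertex\<close>

lemma verts_G3:
  "verts G3 = {Inl 1, Inl 2, Inl 3, Inl 4, Inl 5, Inl 6, Inl 7,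
     Inr 2, Inr 3, Inr 4, Inr 5, Inr 6, Inr 7, Inr 8}"
proof -
  have "{1..7} = {1, 2, 3, 4, 5, 6, 7::nat}" "{1..8} = {1, 2, 3, 4, 5, 6, 7, 8::nat}" by auto
  then show ?thesis
    by (auto simp: G3_def identify_def disjoint_union_def G0_def G2_def)
qed

lemma edges_G3:
  "edges G3 = set [{Inl 1, Inl 2}, {Inl 1, Inl 5}, {Inl 2, Inl 5}, {Inl 2, Inl 3}, {Inl 3, Inl 4},
     {Inl 4, Inl 5}, {Inl 3, Inl 6}, {Inl 4, Inl 7}, {Inl 6, Inr 2}, {Inl 6, Inr 3},
     {Inr 2, Inr 3}, {Inr 2, Inr 4}, {Inr 3, Inr 5}, {Inr 4, Inr 5}, {Inr 4, Inr 6},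
     {Inr 5, Inr 7}, {Inr 6, Inr 7}, {Inr 6, Inr 8}, {Inr 7, Inr 8}]"
  by (simp add: G3_def identify_def disjoint_union_def G0_def G2_def Un_commute insert_commute)

text \<open>An upper bound survives repetitions in the list, so degrees can be bounded by evaluating
  a filter on the list in \<open>edges_G3\<close>.\<close>

lemma card_filter_le_length: "card {x \<in> set xs. P x} \<le> length (filter P xs)"
  by (metis card_length set_filter)

lemma subcubic_G3: "subcubic G3"
proof -
  have "degree G3 v \<le> 3" if "v \<in> verts G3" for v
    using that unfolding degree_def edges_G3 verts_G3
    by (intro order_trans[OF card_filter_le_length]) auto
  moreover have "finite (verts G3)" by (simp add: verts_G3)
  ultimately show ?thesis
    unfolding subcubic_def max_degree_def by (subst Max_le_iff) auto
qed

text \<open>The order in which the outer face visits the vertices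
  (\<open>w\<^sub>1 w\<^sub>2 w\<^sub>3 u\<^sub>1 u\<^sub>2 u\<^sub>4 u\<^sub>6 u\<^sub>8 u\<^sub>7 u\<^sub>5 u\<^sub>3 w\<^sub>7 w\<^sub>4 w\<^sub>5\<close>). The entries at index 0, and \<open>Inr 1\<close>, are unused.\<close>
fun outer_position :: "nat + nat \<Rightarrow> real" where
  "outer_position (Inl i) = [0, 1, 2, 3, 13, 14, 4, 12] ! i"
| "outer_position (Inr i) = [0, 4, 5, 11, 6, 10, 7, 9, 8] ! i"

lemma outerplanar_G3: "outerplanar G3"
proof (rule outerplanar_if_noncrossing[where num = outer_position])
  show "simple_graph G3" by (rule simple_graph_G3)
  show "inj_on outer_position (verts G3)"
    by (simp add: verts_G3)
  have "\<forall>e\<in>edges G3. \<forall>f\<in>edges G3.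
    Min (outer_position ` e) < Min (outer_position ` f) \<longrightarrow>
    Min (outer_position ` f) < Max (outer_position ` e) \<longrightarrow>
    Max (outer_position ` f) \<le> Max (outer_position ` e)"
    by (simp add: edges_G3)
  then show "\<And>e f. e \<in> edges G3 \<Longrightarrow> f \<in> edges G3 \<Longrightarrow>
    Min (outer_position ` e) < Min (outer_position ` f) \<Longrightarrow>
    Min (outer_position ` f) < Max (outer_position ` e) \<Longrightarrow>
    Max (outer_position ` f) \<le> Max (outer_position ` e)"
    by blast
qed

lemma no_packing_edge_coloring_G3: "\<not> packing_edge_coloring [1, 2, 2, 2, 2] G3 C"
proof
  assume coloring: "packing_edge_coloring [1, 2, 2, 2, 2] G3 C"
  note matching = first_class_matching[OF coloring]
  note meet = close_edges_meet_first_class[OF coloring]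
  text \<open>The sets in \<open>hit_w\<close> and \<open>hit_u\<close>, found by search, suffice to make the two claims
    propositional consequences of the matching property.\<close>
  have hit_w:
    "{{Inl 1, Inl 2}, {Inl 1, Inl 5}, {Inl 2, Inl 3}, {Inl 3, Inl 4}, {Inl 4, Inl 5}} \<inter> C 0 \<noteq> {}"
    "{{Inl 1, Inl 5}, {Inl 2, Inl 5}, {Inl 2, Inl 3}, {Inl 3, Inl 4}, {Inl 4, Inl 7}} \<inter> C 0 \<noteq> {}"
    "{{Inl 1, Inl 2}, {Inl 2, Inl 5}, {Inl 2, Inl 3}, {Inl 3, Inl 4}, {Inl 4, Inl 5}} \<inter> C 0 \<noteq> {}"
    "{{Inl 1, Inl 5}, {Inl 2, Inl 5}, {Inl 2, Inl 3}, {Inl 3, Inl 4}, {Inl 4, Inl 5}} \<inter> C 0 \<noteq> {}"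
    by (rule meet; simp add: edges_G3 doubleton_eq_iff)+
  \<comment> \<open>These are all pairs of incident edges of \<open>G0\<close>.\<close>
  have disj_w:
    "\<not> ({Inl 1, Inl 2} \<in> C 0 \<and> {Inl 1, Inl 5} \<in> C 0)"
    "\<not> ({Inl 1, Inl 2} \<in> C 0 \<and> {Inl 2, Inl 3} \<in> C 0)"
    "\<not> ({Inl 1, Inl 2} \<in> C 0 \<and> {Inl 2, Inl 5} \<in> C 0)"
    "\<not> ({Inl 1, Inl 5} \<in> C 0 \<and> {Inl 2, Inl 5} \<in> C 0)"
    "\<not> ({Inl 1, Inl 5} \<in> C 0 \<and> {Inl 4, Inl 5} \<in> C 0)"
    "\<not> ({Inl 2, Inl 3} \<in> C 0 \<and> {Inl 2, Inl 5} \<in> C 0)"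
    "\<not> ({Inl 2, Inl 3} \<in> C 0 \<and> {Inl 3, Inl 4} \<in> C 0)"
    "\<not> ({Inl 2, Inl 3} \<in> C 0 \<and> {Inl 3, Inl 6} \<in> C 0)"
    "\<not> ({Inl 2, Inl 5} \<in> C 0 \<and> {Inl 4, Inl 5} \<in> C 0)"
    "\<not> ({Inl 3, Inl 4} \<in> C 0 \<and> {Inl 3, Inl 6} \<in> C 0)"
    "\<not> ({Inl 3, Inl 4} \<in> C 0 \<and> {Inl 4, Inl 5} \<in> C 0)"
    "\<not> ({Inl 3, Inl 4} \<in> C 0 \<and> {Inl 4, Inl 7} \<in> C 0)"
    "\<not> ({Inl 4, Inl 5} \<in> C 0 \<and> {Inl 4, Inl 7} \<in> C 0)"
    using matching by (fastforce simp: doubleton_eq_iff)+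
  \<comment> \<open>By hand: if w3w6 is in \<open>C 0\<close>, then w2w3 and w3w4 are not, and the
    first set leaves w1w2, w1w5 or w4w5. Here w1w5 contradicts the third set and w4w5 the second,
    while w1w2 forces w4w5 by the fourth.\<close>
  have w: "{Inl 3, Inl 6} \<notin> C 0"
    using hit_w disj_w by (simp add: disj_not1, sat)
  have hit_u:
    "{{Inl 3, Inl 6}, {Inl 6, Inr 2}, {Inl 6, Inr 3}, {Inr 2, Inr 4}, {Inr 3, Inr 5}} \<inter> C 0 \<noteq> {}"
    "{{Inl 6, Inr 2}, {Inr 2, Inr 3}, {Inr 3, Inr 5}, {Inr 4, Inr 5}, {Inr 4, Inr 6}} \<inter> C 0 \<noteq> {}"
    "{{Inl 6, Inr 3}, {Inr 2, Inr 3}, {Inr 2, Inr 4}, {Inr 4, Inr 5}, {Inr 5, Inr 7}} \<inter> C 0 \<noteq> {}"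
    "{{Inl 3, Inl 6}, {Inl 6, Inr 2}, {Inr 2, Inr 3}, {Inr 2, Inr 4}, {Inr 3, Inr 5}} \<inter> C 0 \<noteq> {}"
    "{{Inl 3, Inl 6}, {Inl 6, Inr 3}, {Inr 2, Inr 3}, {Inr 2, Inr 4}, {Inr 3, Inr 5}} \<inter> C 0 \<noteq> {}"
    "{{Inr 4, Inr 5}, {Inr 4, Inr 6}, {Inr 5, Inr 7}, {Inr 6, Inr 7}, {Inr 6, Inr 8}} \<inter> C 0 \<noteq> {}"
    "{{Inr 4, Inr 5}, {Inr 4, Inr 6}, {Inr 5, Inr 7}, {Inr 6, Inr 7}, {Inr 7, Inr 8}} \<inter> C 0 \<noteq> {}"
    "{{Inr 4, Inr 5}, {Inr 4, Inr 6}, {Inr 5, Inr 7}, {Inr 6, Inr 8}, {Inr 7, Inr 8}} \<inter> C 0 \<noteq> {}"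
    by (rule meet; simp add: edges_G3 doubleton_eq_iff)+
  \<comment> \<open>These are all pairs of incident edges of \<open>G2\<close> together with
    w3w6.\<close>
  have disj_u:
    "\<not> ({Inr 2, Inr 3} \<in> C 0 \<and> {Inr 2, Inr 4} \<in> C 0)"
    "\<not> ({Inr 2, Inr 3} \<in> C 0 \<and> {Inl 6, Inr 2} \<in> C 0)"
    "\<not> ({Inr 2, Inr 3} \<in> C 0 \<and> {Inr 3, Inr 5} \<in> C 0)"
    "\<not> ({Inr 2, Inr 3} \<in> C 0 \<and> {Inl 6, Inr 3} \<in> C 0)"
    "\<not> ({Inr 2, Inr 4} \<in> C 0 \<and> {Inl 6, Inr 2} \<in> C 0)"
    "\<not> ({Inr 2, Inr 4} \<in> C 0 \<and> {Inr 4, Inr 5} \<in> C 0)"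
    "\<not> ({Inr 2, Inr 4} \<in> C 0 \<and> {Inr 4, Inr 6} \<in> C 0)"
    "\<not> ({Inl 6, Inr 2} \<in> C 0 \<and> {Inl 6, Inr 3} \<in> C 0)"
    "\<not> ({Inl 6, Inr 2} \<in> C 0 \<and> {Inl 3, Inl 6} \<in> C 0)"
    "\<not> ({Inr 3, Inr 5} \<in> C 0 \<and> {Inl 6, Inr 3} \<in> C 0)"
    "\<not> ({Inr 3, Inr 5} \<in> C 0 \<and> {Inr 4, Inr 5} \<in> C 0)"
    "\<not> ({Inr 3, Inr 5} \<in> C 0 \<and> {Inr 5, Inr 7} \<in> C 0)"
    "\<not> ({Inl 6, Inr 3} \<in> C 0 \<and> {Inl 3, Inl 6} \<in> C 0)"
    "\<not> ({Inr 4, Inr 5} \<in> C 0 \<and> {Inr 4, Inr 6} \<in> C 0)"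
    "\<not> ({Inr 4, Inr 5} \<in> C 0 \<and> {Inr 5, Inr 7} \<in> C 0)"
    "\<not> ({Inr 4, Inr 6} \<in> C 0 \<and> {Inr 6, Inr 7} \<in> C 0)"
    "\<not> ({Inr 4, Inr 6} \<in> C 0 \<and> {Inr 6, Inr 8} \<in> C 0)"
    "\<not> ({Inr 5, Inr 7} \<in> C 0 \<and> {Inr 6, Inr 7} \<in> C 0)"
    "\<not> ({Inr 5, Inr 7} \<in> C 0 \<and> {Inr 7, Inr 8} \<in> C 0)"
    "\<not> ({Inr 6, Inr 7} \<in> C 0 \<and> {Inr 6, Inr 8} \<in> C 0)"
    "\<not> ({Inr 6, Inr 7} \<in> C 0 \<and> {Inr 7, Inr 8} \<in> C 0)"
    "\<not> ({Inr 6, Inr 8} \<in> C 0 \<and> {Inr 7, Inr 8} \<in> C 0)"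
    using matching by (fastforce simp: doubleton_eq_iff)+
  \<comment> \<open>By hand: a matching has at most one edge of a triangle. For u6u7u8, the last
    three sets thus force u4u5, u4u6 or u5u7. If w3w6 is not in \<open>C 0\<close>, the triangle
    u1u2u3 and the first, fourth and fifth sets force u2u4 or u3u5. The only compatible choices are
    u3u5 with u4u6, contradicting the third set, and u2u4 with u5u7, contradicting the
    second.\<close>
  have u: "{Inl 3, Inl 6} \<in> C 0"
    using hit_u disj_u by (simp add: disj_not1, sat)
  show False using w u by blast
qed

theorem mainTheorem7:
  shows "subcubic G3 \<and> outerplanar G3 \<and> \<not> (\<exists>C. packing_edge_coloring [1, 2, 2, 2, 2] G3 C)"
  using subcubic_G3 outerplanar_G3 no_packing_edge_coloring_G3 by blast

end
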